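(* Let $\mathcal{A}$ be a $p\times t$ matrix and $\mathcal{B}$ a $t\times q$ matrix of formal power series in $\mathbb{R}[[x]]$. Then (a) $\mathrm{Lace}(\mathcal{A}\mathcal{B}) = \mathrm{Lace}(\mathcal{A})\,\mathrm{Lace}(\mathcal{B})$; (b) if $\mathcal{A}$ and $\mathcal{B}$ are fully interlacing, then so is $\mathcal{A}\mathcal{B}$.
   Context: A $\mathbb{Z}\times\mathbb{Z}$ real matrix is totally positive (TP) if every finite square submatrix has nonnegative determinant. For a $p\times q$ matrix $\mathcal{A} = (A_{ij}(x))_{0\le i<p,\,0\le j<q}$ of formal power series $A_{ij}(x) = \sum_{n\ge 0} a_{ij}(n)x^n$ (with $a_{ij}(n) = 0$ for $n<0$), $\mathrm{Lace}(\mathcal{A}) = (M_{uv})_{u,v\in\mathbb{Z}}$ is defined by writing $u = pu'+i$, $v = qv'+j$ with $u',v'\in\mathbb{Z}$, $0\le i<p$, $0\le j<q$, and setting $M_{uv} = a_{ij}(v'-u')$. $\mathcal{A}$ is fully interlacing if $\mathrm{Lace}(\mathcal{A})$ is TP. The product $\mathcal{A}\mathcal{B}$ is the usual matrix product over the ring $\mathbb{R}[[x]]$; the product of $\mathbb{Z}\times\mathbb{Z}$ matrices $\mathrm{Lace}(\mathcal{A})\mathrm{Lace}(\mathcal{B})$ has entries $\sum_{w\in\mathbb{Z}} M_{uw}N_{wv}$, which are finite sums here. *)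

theory Defs
  imports "Jordan_Normal_Form.Determinant"
    "HOL-Computational_Algebra.Formal_Power_Series"
    "HOL-Library.Groups_Big_Fun"
begin

definition totally_positive :: "(int \<Rightarrow> int \<Rightarrow> real) \<Rightarrow> bool" where
  "totally_positive M \<longleftrightarrow>
     (\<forall>k (r :: nat \<Rightarrow> int) (c :: nat \<Rightarrow> int).
        strict_mono_on {..<k} r \<longrightarrow> strict_mono_on {..<k} c \<longrightarrow>
        det (mat k k (\<lambda>(i, j). M (r i) (c j))) \<ge> 0)"

definition fps_coeff_int :: "'a::zero fps \<Rightarrow> int \<Rightarrow> 'a" where
  "fps_coeff_int f n = (if n < 0 then 0 else fps_nth f (nat n))"

text \<open>For positive dimensions \<open>p\<close>, \<open>q\<close> the decomposition \<open>u = p u' + i\<close>, \<open>0 \<le> i < p\<close> is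
  \<open>u' = u div p\<close>, \<open>i = u mod p\<close> (also for negative \<open>u\<close>, since division on \<open>int\<close> rounds down).
  The value is meaningless if a dimension is zero.\<close>

definition lace :: "real fps mat \<Rightarrow> int \<Rightarrow> int \<Rightarrow> real" where
  "lace A u v =
     (let p = int (dim_row A); q = int (dim_col A)
      in fps_coeff_int (A $$ (nat (u mod p), nat (v mod q))) (v div q - u div p))"

definition fully_interlacing :: "real fps mat \<Rightarrow> bool" where
  "fully_interlacing A \<longleftrightarrow> totally_positive (lace A)"

text \<open>\<open>Sum_any\<close> sums over the support of the summand; it is the intended sum only if that support
  is finite, which for \<open>lace\<close> matrices is the lemma \<open>finite_lace_mult_support\<close> below.\<close>

definition zmat_mult :: "(int \<Rightarrow> int \<Rightarrow> real) \<Rightarrow> (int \<Rightarrow> int \<Rightarrow> real) \<Rightarrow> int \<Rightarrow> int \<Rightarrow> real" where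
  "zmat_mult M N u v = Sum_any (\<lambda>w. M u w * N w v)"

lemma finite_lace_mult_support:
  assumes "A \<in> carrier_mat p t" "B \<in> carrier_mat t q" "t > 0"
  shows "finite {w. lace A u w * lace B w v \<noteq> 0}"
proof (rule finite_subset)
  show "{w. lace A u w * lace B w v \<noteq> 0}
          \<subseteq> {int t * (u div int p)..int t * (v div int q) + int t}"
  proof
    fix w assume "w \<in> {w. lace A u w * lace B w v \<noteq> 0}"
    hence "u div int p \<le> w div int t" "w div int t \<le> v div int q"
      using assms by (auto simp: lace_def fps_coeff_int_def Let_def split: if_splits)
    hence "int t * (u div int p) \<le> int t * (w div int t)"
      "int t * (w div int t) \<le> int t * (v div int q)"
      by (simp_all add: mult_left_mono)
    moreover have "w = int t * (w div int t) + w mod int t" by simp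
    moreover have "0 \<le> w mod int t" "w mod int t < int t" using assms(3) by simp_all
    ultimately show "w \<in> {int t * (u div int p)..int t * (v div int q) + int t}"
      unfolding atLeastAtMost_iff by linarith
  qed
qed simp

end

theory Submission
  imports Defs
begin

text \<open>Splitting a summation index as \<open>w = t w' + k\<close> turns the product of two lace matrices into
  the Cauchy products that make up the entries of the product of power series matrices.

  Total positivity of the product is the Cauchy--Binet formula. It is used in the symmetrised form
  \<open>k! det (M N) = \<Sum>f. det (M\<^sub>r\<^sub>f) det (N\<^sub>f\<^sub>c)\<close> over all maps \<open>f\<close> from \<open>{0..<k}\<close> to the inner index
  set: a summand with \<open>f\<close> not injective vanishes, and otherwise sorting the values of \<open>f\<close> multiplies
  both factors by the same sign, so that their product is a product of two minors.\<close>

lemma det_mat: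
  "det (mat k k (\<lambda>(i, j). g i j)) =
    (\<Sum>\<pi> | \<pi> permutes {0..<k}. signof \<pi> * (\<Prod>i = 0..<k. g i (\<pi> i)))"
proof -
  have "(\<Prod>i = 0..<k. mat k k (\<lambda>(i, j). g i j) $$ (i, \<pi> i)) = (\<Prod>i = 0..<k. g i (\<pi> i))"
    if "\<pi> permutes {0..<k}" for \<pi>
    using permutes_in_image[OF that] by (intro prod.cong) auto
  then show ?thesis
    by (simp add: det_def)
qed

text \<open>This is multilinearity in the rows: multiplying out a product of \<open>k\<close> sums
  chooses one inner index \<open>f i\<close> for each row \<open>i\<close>. The factors from
  \<open>M\<close> are then independent of \<open>\<pi>\<close>, so the signed sum over
  \<open>\<pi>\<close> only acts on \<open>N\<close>.\<close>

lemma det_prod_expand: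
  fixes M :: "'a \<Rightarrow> 'b \<Rightarrow> 'r :: comm_ring_1" and N :: "'b \<Rightarrow> 'c \<Rightarrow> 'r"
  assumes "finite W"
  shows "det (mat k k (\<lambda>(i, j). \<Sum>w\<in>W. M (r i) w * N w (c j))) =
    (\<Sum>f\<in>{0..<k} \<rightarrow>\<^sub>E W. (\<Prod>i = 0..<k. M (r i) (f i)) * det (mat k k (\<lambda>(i, j). N (f i) (c j))))"
proof -
  let ?P = "{\<pi>. \<pi> permutes {0..<k}}"
  have "det (mat k k (\<lambda>(i, j). \<Sum>w\<in>W. M (r i) w * N w (c j))) =
      (\<Sum>\<pi>\<in>?P. signof \<pi> * (\<Prod>i = 0..<k. \<Sum>w\<in>W. M (r i) w * N w (c (\<pi> i))))"
    by (rule det_mat)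
  also have "\<dots> = (\<Sum>\<pi>\<in>?P. \<Sum>f\<in>{0..<k} \<rightarrow>\<^sub>E W.
      signof \<pi> * (\<Prod>i = 0..<k. M (r i) (f i) * N (f i) (c (\<pi> i))))"
    by (simp add: prod.distrib sum_distrib_left prod_sum_PiE assms)
  also have "\<dots> = (\<Sum>f\<in>{0..<k} \<rightarrow>\<^sub>E W. \<Sum>\<pi>\<in>?P.
      signof \<pi> * (\<Prod>i = 0..<k. M (r i) (f i) * N (f i) (c (\<pi> i))))"
    by (rule sum.swap)
  also have "\<dots> = (\<Sum>f\<in>{0..<k} \<rightarrow>\<^sub>E W.
      (\<Prod>i = 0..<k. M (r i) (f i)) * det (mat k k (\<lambda>(i, j). N (f i) (c j))))"
  proof (rule sum.cong[OF refl])
    fix f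
    have "det (mat k k (\<lambda>(i, j). N (f i) (c j))) =
        (\<Sum>\<pi>\<in>?P. signof \<pi> * (\<Prod>i = 0..<k. N (f i) (c (\<pi> i))))"
      by (rule det_mat)
    then show "(\<Sum>\<pi>\<in>?P. signof \<pi> * (\<Prod>i = 0..<k. M (r i) (f i) * N (f i) (c (\<pi> i)))) =
        (\<Prod>i = 0..<k. M (r i) (f i)) * det (mat k k (\<lambda>(i, j). N (f i) (c j)))"
      by (simp add: prod.distrib sum_distrib_left mult_ac)
  qed
  finally show ?thesis .
qed

lemma det_permute_row_labels:
  assumes "\<pi> permutes {0..<k}"
  shows "det (mat k k (\<lambda>(i, j). N (f (\<pi> i)) (c j))) =
    signof \<pi> * (det (mat k k (\<lambda>(i, j). N (f i) (c j))) :: 'r :: comm_ring_1)"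
proof -
  have less: "\<pi> i < k" if "i < k" for i
    using that permutes_in_image[OF assms, of i] by simp
  have "mat k k (\<lambda>(i, j). N (f (\<pi> i)) (c j)) =
      mat k k (\<lambda>(i, j). mat k k (\<lambda>(i, j). N (f i) (c j)) $$ (\<pi> i, j))"
    using less by (intro eq_matI) simp_all
  then show ?thesis
    by (simp only: det_permute_rows[OF mat_carrier assms])
qed

lemma det_permute_col_labels:
  assumes "\<pi> permutes {0..<k}"
  shows "det (mat k k (\<lambda>(i, j). M (r i) (f (\<pi> j)))) =
    signof \<pi> * (det (mat k k (\<lambda>(i, j). M (r i) (f j))) :: 'r :: comm_ring_1)"
proof -
  have tr: "det (mat k k (\<lambda>(i, j). M (r i) (g j))) = det (mat k k (\<lambda>(i, j). M (r j) (g i)))" for g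
  proof -
    have "transpose_mat (mat k k (\<lambda>(i, j). M (r i) (g j))) = mat k k (\<lambda>(i, j). M (r j) (g i))"
      by (auto intro!: eq_matI)
    then show ?thesis
      by (metis det_transpose mat_carrier)
  qed
  \<comment> \<open>Columns become rows after transposition, so the row version is applied to the
    flipped kernel, with \<open>f\<close> labelling rows and \<open>r\<close> labelling
    columns.\<close>
  show ?thesis
    using det_permute_row_labels[OF assms, of "\<lambda>x y. M y x" f r]
    by (simp add: tr[of f] tr[of "\<lambda>j. f (\<pi> j)"])
qed

text \<open>Each permutation of the positions of \<open>f\<close> gives another form of the
  expansion in \<open>det_prod_expand\<close>. Adding up all \<open>fact k\<close> forms completes
  the product of entries of \<open>M\<close> to a determinant.\<close>

lemma cauchy_binet_symmetrised:
  fixes M :: "'a \<Rightarrow> 'b \<Rightarrow> 'r :: comm_ring_1" and N :: "'b \<Rightarrow> 'c \<Rightarrow> 'r"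
  assumes "finite W"
  shows "of_nat (fact k) * det (mat k k (\<lambda>(i, j). \<Sum>w\<in>W. M (r i) w * N w (c j))) =
    (\<Sum>f\<in>{0..<k} \<rightarrow>\<^sub>E W. det (mat k k (\<lambda>(i, j). M (r i) (f j))) *
                              det (mat k k (\<lambda>(i, j). N (f i) (c j))))"
proof -
  let ?P = "{\<pi>. \<pi> permutes {0..<k}}"
  let ?F = "{0..<k} \<rightarrow>\<^sub>E W"
  let ?D = "det (mat k k (\<lambda>(i, j). \<Sum>w\<in>W. M (r i) w * N w (c j)))"
  let ?dN = "\<lambda>f. det (mat k k (\<lambda>(i, j). N (f i) (c j)))"
  \<comment> \<open>Substituting \<open>f \<circ> \<pi>\<close> for \<open>f\<close> permutes the
    summands and moves \<open>\<pi>\<close> into the \<open>M\<close> factors; undoing it in the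
    rows of \<open>N\<close> costs the sign.\<close>
  have D: "?D = (\<Sum>f\<in>?F. (\<Prod>i = 0..<k. M (r i) (f (\<pi> i))) * (signof \<pi> * ?dN f))"
    if \<pi>: "\<pi> permutes {0..<k}" for \<pi>
  proof -
    have "?D = (\<Sum>f\<in>?F. (\<Prod>i = 0..<k. M (r i) (f i)) * ?dN f)"
      by (rule det_prod_expand[OF assms])
    also have "\<dots> = (\<Sum>f\<in>?F. (\<Prod>i = 0..<k. M (r i) ((f \<circ> \<pi>) i)) * ?dN (f \<circ> \<pi>))"
    proof (rule sum.reindex_bij_witness[where i = "\<lambda>f. f \<circ> \<pi>" and j = "\<lambda>f. f \<circ> inv_into UNIV \<pi>"])
      \<comment> \<open>Outside \<open>{0..<k}\<close> the permutation is the identity, so the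
        composite keeps the default value \<open>undefined\<close> that extensionality
        demands.\<close>
      have comp: "f \<circ> \<sigma> \<in> ?F" if "f \<in> ?F" "\<sigma> permutes {0..<k}" for f \<sigma>
        using that permutes_in_image[OF that(2)] permutes_not_in[OF that(2)]
        by (fastforce simp: PiE_iff extensional_def)
      show "f \<circ> \<pi> \<in> ?F" "f \<circ> inv_into UNIV \<pi> \<in> ?F" if "f \<in> ?F" for f
        using comp that \<pi> permutes_inv by blast+
    qed (simp_all add: comp_assoc permutes_inv_o[OF \<pi>])
    finally show ?thesis
      by (simp add: det_permute_row_labels[OF \<pi>])
  qed
  have "of_nat (fact k) * ?D = (\<Sum>\<pi>\<in>?P. ?D)"
    by (simp add: card_permutations)
  also have "\<dots> = (\<Sum>\<pi>\<in>?P. \<Sum>f\<in>?F. (\<Prod>i = 0..<k. M (r i) (f (\<pi> i))) * (signof \<pi> * ?dN f))"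
    by (rule sum.cong[OF refl]) (use D in blast)
  also have "\<dots> = (\<Sum>f\<in>?F. \<Sum>\<pi>\<in>?P. (\<Prod>i = 0..<k. M (r i) (f (\<pi> i))) * (signof \<pi> * ?dN f))"
    by (rule sum.swap)
  also have "\<dots> = (\<Sum>f\<in>?F. det (mat k k (\<lambda>(i, j). M (r i) (f j))) * ?dN f)"
  proof (rule sum.cong[OF refl])
    fix f
    have "det (mat k k (\<lambda>(i, j). M (r i) (f j))) =
        (\<Sum>\<pi>\<in>?P. signof \<pi> * (\<Prod>i = 0..<k. M (r i) (f (\<pi> i))))"
      by (rule det_mat)
    then show "(\<Sum>\<pi>\<in>?P. (\<Prod>i = 0..<k. M (r i) (f (\<pi> i))) * (signof \<pi> * ?dN f)) =
        det (mat k k (\<lambda>(i, j). M (r i) (f j))) * ?dN f"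
      by (simp add: sum_distrib_left mult_ac)
  qed
  finally show ?thesis .
qed

text \<open>Sorting the positions, not the values, with \<open>f\<close> as key yields a list that
  is itself the required permutation in one-line notation.\<close>

lemma inj_on_sorting_permutation:
  fixes f :: "nat \<Rightarrow> 'a :: linorder"
  assumes "inj_on f {0..<k}"
  obtains \<sigma> where "\<sigma> permutes {0..<k}" "strict_mono_on {..<k} (f \<circ> \<sigma>)"
proof -
  define xs where "xs = sort_key f [0..<k]"
  define \<sigma> where "\<sigma> = (\<lambda>i. if i < k then xs ! i else i)"
  have len: "length xs = k" and set: "set xs = {0..<k}" and dist: "distinct xs"
    by (simp_all add: xs_def)
  have "bij_betw \<sigma> {0..<k} {0..<k}"
    using bij_betw_nth[OF dist, of "{0..<k}" "{0..<k}"] bij_betw_cong[of "{0..<k}" \<sigma> "(!) xs"]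
    by (simp add: \<sigma>_def len set atLeast0LessThan)
  then have perm: "\<sigma> permutes {0..<k}"
    by (rule bij_imp_permutes) (simp add: \<sigma>_def)
  have "strict_mono_on {..<k} (f \<circ> \<sigma>)"
  proof (rule strict_mono_onI)
    fix i j assume ij: "i \<in> {..<k}" "j \<in> {..<k}" "i < j"
    have "sorted (map f xs)"
      by (simp add: xs_def)
    then have "f (xs ! i) \<le> f (xs ! j)"
      using ij len by (auto simp: sorted_iff_nth_mono)
    \<comment> \<open>Sortedness gives only a weak inequality; distinctness of \<open>xs\<close> and
      injectivity of \<open>f\<close> make it strict.\<close>
    moreover have "f (xs ! i) \<noteq> f (xs ! j)"
    proof -
      have "xs ! i \<in> {0..<k}" "xs ! j \<in> {0..<k}" "xs ! i \<noteq> xs ! j"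
        using ij len set dist nth_mem[of i xs] nth_mem[of j xs] by (auto simp: nth_eq_iff_index_eq)
      then show ?thesis
        using assms by (auto dest: inj_onD)
    qed
    ultimately show "(f \<circ> \<sigma>) i < (f \<circ> \<sigma>) j"
      using ij by (simp add: \<sigma>_def)
  qed
  with perm show thesis by (rule that)
qed

lemma totally_positive_minor_product_nonneg:
  assumes M: "totally_positive M" and N: "totally_positive N"
    and r: "strict_mono_on {..<k} r" and c: "strict_mono_on {..<k} c"
  shows "det (mat k k (\<lambda>(i, j). M (r i) (f j))) * det (mat k k (\<lambda>(i, j). N (f i) (c j))) \<ge> 0"
proof (cases "inj_on f {0..<k}")
  case True
  then obtain \<sigma> where \<sigma>: "\<sigma> permutes {0..<k}" "strict_mono_on {..<k} (f \<circ> \<sigma>)"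
    by (rule inj_on_sorting_permutation)
  have "0 \<le> det (mat k k (\<lambda>(i, j). M (r i) ((f \<circ> \<sigma>) j))) *
             det (mat k k (\<lambda>(i, j). N ((f \<circ> \<sigma>) i) (c j)))"
    using M N r c \<sigma>(2) unfolding totally_positive_def by (intro mult_nonneg_nonneg) blast+
  \<comment> \<open>Sorting the columns of one factor and the rows of the other produces the sign of
    \<open>\<sigma>\<close> twice, and its square is 1.\<close>
  also have "\<dots> = det (mat k k (\<lambda>(i, j). M (r i) (f j))) *
      det (mat k k (\<lambda>(i, j). N (f i) (c j)))"
    by (simp add: det_permute_row_labels[OF \<sigma>(1)] det_permute_col_labels[OF \<sigma>(1)] sign_def)
  finally show ?thesis .
next
  case False
  then obtain a b where ab: "a < k" "b < k" "a \<noteq> b" "f a = f b"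
    by (auto simp: inj_on_def)
  \<comment> \<open>Rows \<open>a\<close> and \<open>b\<close> carry the same label, so they
    coincide.\<close>
  have "det (mat k k (\<lambda>(i, j). N (f i) (c j))) = 0"
    by (rule det_identical_rows[OF mat_carrier ab(3,1,2)]) (use ab in auto)
  then show ?thesis by simp
qed

lemma totally_positive_zmat_mult:
  assumes M: "totally_positive M" and N: "totally_positive N"
    and fin: "\<And>u v. finite {w. M u w * N w v \<noteq> 0}"
  shows "totally_positive (zmat_mult M N)"
  unfolding totally_positive_def
proof (intro allI impI)
  fix k :: nat and r c :: "nat \<Rightarrow> int"
  assume r: "strict_mono_on {..<k} r" and c: "strict_mono_on {..<k} c"
  \<comment> \<open>A minor involves only finitely many entries, so their finite supports have a
    finite union over which all these sums can be taken.\<close>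
  define W where "W = (\<Union>i<k. \<Union>j<k. {w. M (r i) w * N w (c j) \<noteq> 0})"
  have W: "finite W"
    using fin by (simp add: W_def)
  have "zmat_mult M N (r i) (c j) = (\<Sum>w\<in>W. M (r i) w * N w (c j))" if "i < k" "j < k" for i j
    unfolding zmat_mult_def using that by (intro Sum_any.expand_superset W) (auto simp: W_def)
  then have eq: "mat k k (\<lambda>(i, j). zmat_mult M N (r i) (c j)) =
      mat k k (\<lambda>(i, j). \<Sum>w\<in>W. M (r i) w * N w (c j))"
    by (auto intro!: eq_matI)
  have "0 \<le> real (fact k) * det (mat k k (\<lambda>(i, j). zmat_mult M N (r i) (c j)))"
    unfolding eq cauchy_binet_symmetrised[OF W]
    by (intro sum_nonneg totally_positive_minor_product_nonneg M N r c)
  then show "0 \<le> det (mat k k (\<lambda>(i, j). zmat_mult M N (r i) (c j)))"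
    by (simp add: zero_le_mult_iff fact_gt_zero[folded not_le])
qed

lemma fps_coeff_int_sum:
  "fps_coeff_int (\<Sum>k\<in>K. f k) n = (\<Sum>k\<in>K. fps_coeff_int (f k) n)"
  by (simp add: fps_coeff_int_def fps_sum_nth)

text \<open>This is the Cauchy product with its index shifted to start at \<open>a\<close>, the
  shape in which it appears in a lace product. For \<open>b < a\<close> the interval is empty,
  matching the zero coefficient at a negative index.\<close>

lemma fps_coeff_int_mult:
  "fps_coeff_int (f * g) (b - a) =
    (\<Sum>w = a..b. fps_coeff_int f (w - a) * fps_coeff_int g (b - w))"
proof (cases "a \<le> b")
  case True
  have diff: "nat (b - (a + int i)) = nat (b - a) - i" for i
    by linarith
  have "fps_coeff_int (f * g) (b - a) =
      (\<Sum>i = 0..nat (b - a). fps_nth f i * fps_nth g (nat (b - a) - i))"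
    using True by (simp add: fps_coeff_int_def fps_mult_nth)
  also have "\<dots> = (\<Sum>w = a..b. fps_coeff_int f (w - a) * fps_coeff_int g (b - w))"
    using True
    by (intro sum.reindex_bij_witness[where i = "\<lambda>w. nat (w - a)" and j = "\<lambda>i. a + int i"])
      (auto simp: fps_coeff_int_def diff)
  finally show ?thesis .
qed (simp add: fps_coeff_int_def)

lemma lace_mult:
  assumes "p > 0" "t > 0" "q > 0" and A: "A \<in> carrier_mat p t" and B: "B \<in> carrier_mat t q"
  shows "lace (A * B) = zmat_mult (lace A) (lace B)"
proof (intro ext)
  fix u v :: int
  define i j a b where "i = nat (u mod int p)" and "j = nat (v mod int q)"
    and "a = u div int p" and "b = v div int q"
  have ij: "i < p" "j < q"
    using assms by (auto simp: i_def j_def nat_less_iff)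
  let ?S = "{a..b} \<times> {0..<t}"
  let ?h = "\<lambda>(w', k). w' * int t + int k"
  \<comment> \<open>Division with remainder by \<open>t\<close> inverts \<open>?h\<close>.\<close>
  have inj: "inj_on ?h ?S"
  proof (rule inj_on_inverseI[where g = "\<lambda>w. (w div int t, nat (w mod int t))"])
    fix x assume "x \<in> ?S"
    then show "(?h x div int t, nat (?h x mod int t)) = x"
      using assms(2) by auto
  qed
  \<comment> \<open>Coefficients at negative indices vanish: the factor from \<open>A\<close> forces
    \<open>a \<le> w div int t\<close>, the one from \<open>B\<close> forces
    \<open>w div int t \<le> b\<close>.\<close>
  have supp: "{w. lace A u w * lace B w v \<noteq> 0} \<subseteq> ?h ` ?S"
  proof
    fix w assume "w \<in> {w. lace A u w * lace B w v \<noteq> 0}"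
    then have "a \<le> w div int t" "w div int t \<le> b"
      using A B by (auto simp: lace_def fps_coeff_int_def Let_def a_def b_def split: if_splits)
    then show "w \<in> ?h ` ?S"
      using assms(2)
      by (intro image_eqI[where x = "(w div int t, nat (w mod int t))"]) (auto simp: nat_less_iff)
  qed
  have "zmat_mult (lace A) (lace B) u v = (\<Sum>w\<in>?h ` ?S. lace A u w * lace B w v)"
    unfolding zmat_mult_def using supp by (intro Sum_any.expand_superset) auto
  also have "\<dots> = (\<Sum>x\<in>?S. lace A u (?h x) * lace B (?h x) v)"
    by (rule sum.reindex[OF inj, unfolded o_def])
  also have "\<dots> = (\<Sum>(w', k)\<in>?S.
      fps_coeff_int (A $$ (i, k)) (w' - a) * fps_coeff_int (B $$ (k, j)) (b - w'))"
    using A B by (intro sum.cong) (auto simp: lace_def Let_def i_def j_def a_def b_def)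
  also have "\<dots> = (\<Sum>k = 0..<t. \<Sum>w' = a..b.
      fps_coeff_int (A $$ (i, k)) (w' - a) * fps_coeff_int (B $$ (k, j)) (b - w'))"
    \<comment> \<open>With the block index \<open>w'\<close> innermost, each inner sum is a Cauchy
      product for one fixed \<open>k\<close>.\<close>
    by (subst sum.cartesian_product[symmetric], rule sum.swap)
  also have "\<dots> = fps_coeff_int (\<Sum>k = 0..<t. A $$ (i, k) * B $$ (k, j)) (b - a)"
    by (simp only: fps_coeff_int_sum fps_coeff_int_mult)
  also have "(\<Sum>k = 0..<t. A $$ (i, k) * B $$ (k, j)) = (A * B) $$ (i, j)"
    using A B ij by (simp add: scalar_prod_def)
  also have "fps_coeff_int ((A * B) $$ (i, j)) (b - a) = lace (A * B) u v"
    using A B by (simp add: lace_def Let_def i_def j_def a_def b_def)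
  finally show "lace (A * B) u v = zmat_mult (lace A) (lace B) u v" by simp
qed

theorem theorem4p3:
  fixes A B :: "real fps mat" and p t q :: nat
  assumes "p > 0" and "t > 0" and "q > 0"
    and "A \<in> carrier_mat p t" and "B \<in> carrier_mat t q"
  shows "lace (A * B) = zmat_mult (lace A) (lace B) \<and>
    (fully_interlacing A \<and> fully_interlacing B \<longrightarrow> fully_interlacing (A * B))"
proof -
  have "lace (A * B) = zmat_mult (lace A) (lace B)"
    by (rule lace_mult[OF assms])
  \<comment> \<open>The factorisation reduces the second claim to closure of total positivity under
    products, whose finiteness condition is the support bound for lace matrices.\<close>
  then show ?thesis
    using totally_positive_zmat_mult[of "lace A" "lace B"]
      finite_lace_mult_support[OF assms(4,5,2)]
    by (simp add: fully_interlacing_def)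
qed

end
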